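(* Let $\Omega=[0,1]$. The Hilbert space $L^2(\Omega)$ has the orthogonal decomposition $$L^2(\Omega)=A^2(\Omega)\oplus D\left(W_0^{1,2}(\Omega)\right),$$ that is, the subspaces $A^2(\Omega)$ and $D(W_0^{1,2}(\Omega))$ are orthogonal to each other in $L^2(\Omega)$, and every $f\in L^2(\Omega)$ can be written in a unique way as $f=g+\eta$ with $g\in A^2(\Omega)$ and $\eta\in D(W_0^{1,2}(\Omega))$.
   Context: $\Omega=[0,1]$, $\partial\Omega=\{0,1\}$, and $D=\frac{d}{dx}$ (weak derivative). $L^2(\Omega)$ is the real Hilbert space of (classes of) measurable functions $f:\Omega\to\mathbb{R}$ with $\int_\Omega f^2\,dx<\infty$, with inner product $\langle f,g\rangle=\int_\Omega f(x)g(x)\,dx$. $W^{1,2}(\Omega)=\{f\in L^2(\Omega): Df\in L^2(\Omega)\}$, and $W_0^{1,2}(\Omega)=\{f\in W^{1,2}(\Omega): f|_{\partial\Omega}=0\}$, where the restriction to $\partial\Omega$ is in the sense of trace (boundary values of the continuous representative). $D(W_0^{1,2}(\Omega))=\{Dh: h\in W_0^{1,2}(\Omega)\}$. $A^2(\Omega)=\{g\in L^2(\Omega): Dg=0 \text{ on } \Omega\}$, i.e. the space of constant functions. *)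

theory Defs
  imports "HOL-Analysis.Analysis"
begin

section \<open>The Hilbert space $L^2([0,1])$\<close>

abbreviation unit_leb :: "real measure" where
  "unit_leb \<equiv> lebesgue_on {0..1}"

definition square_integrable :: "(real \<Rightarrow> real) \<Rightarrow> bool" where
  "square_integrable f \<longleftrightarrow> f \<in> borel_measurable unit_leb \<and> integrable unit_leb (\<lambda>x. (f x)\<^sup>2)"

lemma square_integrable_measurable [measurable_dest]:
  "square_integrable f \<Longrightarrow> f \<in> borel_measurable unit_leb"
  by (simp add: square_integrable_def)

lemma square_integrable_mult:
  assumes "square_integrable f" "square_integrable g"
  shows "integrable unit_leb (\<lambda>x. f x * g x)"
proof (rule Bochner_Integration.integrable_bound)
  show "integrable unit_leb (\<lambda>x. (f x)\<^sup>2 + (g x)\<^sup>2)"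
    using assms by (simp add: square_integrable_def)
  show "(\<lambda>x. f x * g x) \<in> borel_measurable unit_leb"
    using assms by (intro borel_measurable_times) (simp_all add: square_integrable_def)
  have "\<bar>a * b\<bar> \<le> \<bar>a\<^sup>2 + b\<^sup>2\<bar>" for a b :: real
  proof -
    have "0 \<le> (\<bar>a\<bar> - \<bar>b\<bar>)\<^sup>2" by simp
    then have "2 * \<bar>a * b\<bar> \<le> a\<^sup>2 + b\<^sup>2"
      by (simp add: power2_diff abs_mult)
    then show ?thesis
      using abs_ge_zero[of "a * b"] by linarith
  qed
  then show "AE x in unit_leb. norm (f x * g x) \<le> norm ((f x)\<^sup>2 + (g x)\<^sup>2)"
    by simp
qed

lemma square_integrable_add:
  assumes "square_integrable f" "square_integrable g"
  shows "square_integrable (\<lambda>x. f x + g x)"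
proof -
  have "integrable unit_leb (\<lambda>x. (f x)\<^sup>2 + (g x)\<^sup>2 + 2 * (f x * g x))"
    using assms square_integrable_mult[OF assms] by (simp add: square_integrable_def)
  then show ?thesis
    using assms by (simp add: square_integrable_def power2_sum mult.assoc borel_measurable_add)
qed

lemma square_integrable_cmult:
  "square_integrable f \<Longrightarrow> square_integrable (\<lambda>x. c * f x)"
  by (simp add: square_integrable_def power_mult_distrib borel_measurable_times)

lemma square_integrable_zero: "square_integrable (\<lambda>x. 0)"
  by (simp add: square_integrable_def)

definition l2_eq :: "(real \<Rightarrow> real) \<Rightarrow> (real \<Rightarrow> real) \<Rightarrow> bool" where
  "l2_eq f g \<longleftrightarrow> square_integrable f \<and> square_integrable g \<and> (AE x in unit_leb. f x = g x)"

lemma part_equivp_l2_eq: "part_equivp l2_eq"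
proof (rule part_equivpI)
  show "\<exists>f. l2_eq f f"
    using square_integrable_zero by (auto simp: l2_eq_def)
  show "symp l2_eq"
    by (auto simp: l2_eq_def symp_def elim: AE_mp)
  show "transp l2_eq"
    by (auto simp: l2_eq_def transp_def elim: AE_mp)
qed

text \<open>Elements are classes of functions on the whole real line, but only the values on the unit
  interval matter.\<close>

quotient_type l2 = "real \<Rightarrow> real" / partial: l2_eq
  by (rule part_equivp_l2_eq)

instantiation l2 :: real_vector
begin

lift_definition zero_l2 :: l2 is "\<lambda>x. 0"
  by (simp add: l2_eq_def square_integrable_zero)

lift_definition plus_l2 :: "l2 \<Rightarrow> l2 \<Rightarrow> l2" is "\<lambda>f g x. f x + g x"
  by (auto simp: l2_eq_def square_integrable_add)

lift_definition scaleR_l2 :: "real \<Rightarrow> l2 \<Rightarrow> l2" is "\<lambda>c f x. c * f x"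
  by (auto simp: l2_eq_def square_integrable_cmult)

lift_definition uminus_l2 :: "l2 \<Rightarrow> l2" is "\<lambda>f x. - f x"
  using square_integrable_cmult[of _ "-1"] by (auto simp: l2_eq_def)

definition minus_l2 :: "l2 \<Rightarrow> l2 \<Rightarrow> l2" where
  "minus_l2 f g = f + (- g)"

instance
proof
  fix a b c :: l2 and r s :: real
  show "a + b + c = a + (b + c)"
    by transfer (auto simp: l2_eq_def square_integrable_add add.assoc)
  show "a + b = b + a"
    by transfer (auto simp: l2_eq_def square_integrable_add add.commute)
  show "0 + a = a"
    by transfer (auto simp: l2_eq_def)
  show "- a + a = 0"
    by transfer (auto simp: l2_eq_def square_integrable_zero)
  show "a - b = a + - b"
    by (rule minus_l2_def)
  show "r *\<^sub>R (a + b) = r *\<^sub>R a + r *\<^sub>R b"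
    by transfer (auto simp: l2_eq_def distrib_left intro!: square_integrable_add square_integrable_cmult)
  show "(r + s) *\<^sub>R a = r *\<^sub>R a + s *\<^sub>R a"
    by transfer (auto simp: l2_eq_def distrib_right intro!: square_integrable_add square_integrable_cmult)
  show "r *\<^sub>R s *\<^sub>R a = (r * s) *\<^sub>R a"
    by transfer (auto simp: l2_eq_def mult.assoc intro!: square_integrable_cmult)
  show "1 *\<^sub>R a = a"
    by transfer (auto simp: l2_eq_def)
qed

end

instantiation l2 :: real_inner
begin

lift_definition inner_l2 :: "l2 \<Rightarrow> l2 \<Rightarrow> real" is
  "\<lambda>f g. LINT x|unit_leb. f x * g x"
  by (intro integral_cong_AE) (auto simp: l2_eq_def square_integrable_def elim: AE_mp)

definition norm_l2 :: "l2 \<Rightarrow> real" where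
  "norm_l2 f = sqrt (inner f f)"

definition sgn_l2 :: "l2 \<Rightarrow> l2" where
  "sgn_l2 f = inverse (norm f) *\<^sub>R f"

definition dist_l2 :: "l2 \<Rightarrow> l2 \<Rightarrow> real" where
  "dist_l2 f g = norm (f - g)"

definition uniformity_l2 :: "(l2 \<times> l2) filter" where
  "uniformity_l2 = (INF e\<in>{0<..}. principal {(f, g). dist f g < e})"

definition open_l2 :: "l2 set \<Rightarrow> bool" where
  "open_l2 U \<longleftrightarrow> (\<forall>f\<in>U. eventually (\<lambda>(f', g). f' = f \<longrightarrow> g \<in> U) uniformity)"

instance
proof
  fix a b c :: l2 and r :: real and U :: "l2 set"
  show "dist a b = norm (a - b)" by (rule dist_l2_def)
  show "sgn a = inverse (norm a) *\<^sub>R a" by (rule sgn_l2_def)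
  show "(uniformity :: (l2 \<times> l2) filter) = (INF e\<in>{0<..}. principal {(f, g). dist f g < e})"
    by (rule uniformity_l2_def)
  show "open U \<longleftrightarrow> (\<forall>f\<in>U. eventually (\<lambda>(f', g). f' = f \<longrightarrow> g \<in> U) uniformity)"
    by (rule open_l2_def)
  show "inner a b = inner b a"
    by transfer (simp add: mult.commute)
  show "inner (a + b) c = inner a c + inner b c"
    by transfer (simp add: l2_eq_def distrib_right square_integrable_mult)
  show "inner (r *\<^sub>R a) b = r * inner a b"
    by transfer (simp add: l2_eq_def mult.assoc square_integrable_mult)
  show "0 \<le> inner a a"
    by transfer simp
  show "inner a a = 0 \<longleftrightarrow> a = 0"
    by transfer (auto simp: l2_eq_def square_integrable_zero square_integrable_mult
      integral_nonneg_eq_0_iff_AE)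
  show "norm a = sqrt (inner a a)" by (rule norm_l2_def)
qed

end

lemma half_power_sq: "((1/2) ^ m)\<^sup>2 = ((1/4)::real) ^ m"
proof -
  have "((1/2) ^ m)\<^sup>2 = (((1/2)::real)\<^sup>2) ^ m"
    by (metis power_mult mult.commute)
  then show ?thesis by (simp add: power2_eq_square)
qed

lemma l2_cases:
  obtains f where "square_integrable f" "a = abs_l2 f"
proof -
  have "l2_eq (rep_l2 a) (rep_l2 a)" "abs_l2 (rep_l2 a) = a"
    by (rule Quotient3_rep_reflp[OF Quotient3_l2], rule Quotient3_abs_rep[OF Quotient3_l2])
  then show thesis
    using that[of "rep_l2 a"] by (simp add: l2_eq_def)
qed

lemma dist_abs_l2:
  assumes "square_integrable f" "square_integrable g"
  shows "square_integrable (\<lambda>x. f x - g x)"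
    and "dist (abs_l2 f) (abs_l2 g) = sqrt (LINT x|unit_leb. (f x - g x)\<^sup>2)"
proof -
  have g: "square_integrable (\<lambda>x. - g x)"
    using square_integrable_cmult[OF assms(2), of "-1"] by simp
  have r: "l2_eq h h" if "square_integrable h" for h
    using that by (simp add: l2_eq_def)
  show d: "square_integrable (\<lambda>x. f x - g x)"
    using square_integrable_add[OF assms(1) g] by simp
  have "abs_l2 f - abs_l2 g = abs_l2 (\<lambda>x. f x - g x)"
    using assms g r by (simp add: minus_l2_def uminus_l2.abs_eq plus_l2.abs_eq)
  then show "dist (abs_l2 f) (abs_l2 g) = sqrt (LINT x|unit_leb. (f x - g x)\<^sup>2)"
    using r[OF d] by (simp add: dist_norm norm_l2_def inner_l2.abs_eq power2_eq_square)
qed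

lemma abs_l2_fast_Cauchy_convergent:
  fixes f :: "nat \<Rightarrow> real \<Rightarrow> real"
  assumes f: "\<And>n. square_integrable (f n)"
    and fast: "\<And>m n. m \<le> n \<Longrightarrow> dist (abs_l2 (f n)) (abs_l2 (f m)) \<le> (1/2) ^ m"
  shows "convergent (\<lambda>n. abs_l2 (f n))"
proof -
  have meas [measurable]: "f n \<in> borel_measurable unit_leb" for n
    using f by (rule square_integrable_measurable)
  have int: "integrable unit_leb (\<lambda>x. (f n x - f m x)\<^sup>2)" for m n
    using dist_abs_l2(1)[OF f f] by (simp add: square_integrable_def)
  have le: "(LINT x|unit_leb. (f n x - f m x)\<^sup>2) \<le> (1/4) ^ m" if "m \<le> n" for m n
  proof -
    have "sqrt (LINT x|unit_leb. (f n x - f m x)\<^sup>2) \<le> (1/2) ^ m"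
      using fast[OF that] dist_abs_l2(2)[OF f f] by simp
    then have "(LINT x|unit_leb. (f n x - f m x)\<^sup>2) \<le> ((1/2) ^ m)\<^sup>2"
      by (rule sqrt_le_D)
    then show ?thesis by (simp only: half_power_sq)
  qed
  define F where "F = (\<lambda>x. lim (\<lambda>n. f n x))"
  have F [measurable]: "F \<in> borel_measurable unit_leb"
    unfolding F_def by (rule borel_measurable_lim_metric) (rule meas)
  have mono: "ennreal \<bar>f (Suc n) x - f n x\<bar> \<le> ennreal (2 ^ n * (f (Suc n) x - f n x)\<^sup>2 + (1/2) ^ n)" for n x
  proof (rule ennreal_leI)
    define h where "h = \<bar>f (Suc n) x - f n x\<bar>"
    define c where "c = (2::real) ^ n"
    have c: "c > 0" "(1/2) ^ n = 1 / c"
      by (simp_all add: c_def power_divide)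
    have "0 \<le> (c * h - 1)\<^sup>2 / c"
      using c by simp
    also have "\<dots> = c * h\<^sup>2 + 1 / c - 2 * h"
      using c by (simp add: power2_eq_square field_simps)
    finally have "2 * h \<le> 2 ^ n * h\<^sup>2 + (1/2) ^ n"
      using c unfolding c_def by simp
    moreover have "0 \<le> h" by (simp add: h_def)
    ultimately have "h \<le> 2 ^ n * h\<^sup>2 + (1/2) ^ n" by linarith
    then show "\<bar>f (Suc n) x - f n x\<bar> \<le> 2 ^ n * (f (Suc n) x - f n x)\<^sup>2 + (1/2) ^ n"
      by (simp add: h_def)
  qed
  have L1: "(\<integral>\<^sup>+x. ennreal \<bar>f (Suc n) x - f n x\<bar> \<partial>unit_leb) \<le> ennreal (2 * (1/2) ^ n)" for n
  proof -
    have "(\<integral>\<^sup>+x. ennreal \<bar>f (Suc n) x - f n x\<bar> \<partial>unit_leb)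
        \<le> (\<integral>\<^sup>+x. ennreal (2 ^ n * (f (Suc n) x - f n x)\<^sup>2 + (1/2) ^ n) \<partial>unit_leb)"
      by (intro nn_integral_mono mono)
    also have "\<dots> = ennreal (LINT x|unit_leb. 2 ^ n * (f (Suc n) x - f n x)\<^sup>2 + (1/2) ^ n)"
      using int by (intro nn_integral_eq_integral) auto
    also have "(LINT x|unit_leb. 2 ^ n * (f (Suc n) x - f n x)\<^sup>2 + (1/2) ^ n)
        = 2 ^ n * (LINT x|unit_leb. (f (Suc n) x - f n x)\<^sup>2) + (1/2) ^ n"
      using int by (simp add: measure_restrict_space)
    also have "\<dots> \<le> 2 ^ n * (1/4) ^ n + (1/2) ^ n"
      using le[of n "Suc n"] by simp
    also have "\<dots> = 2 * (1/2) ^ n"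
    proof -
      have "2 ^ n * (1/4) ^ n = (2 * (1/4) :: real) ^ n"
        by (rule power_mult_distrib[symmetric])
      then show ?thesis by simp
    qed
    finally show ?thesis by (simp add: ennreal_leI)
  qed
  have "(\<integral>\<^sup>+x. (\<Sum>n. ennreal \<bar>f (Suc n) x - f n x\<bar>) \<partial>unit_leb)
      = (\<Sum>n. \<integral>\<^sup>+x. ennreal \<bar>f (Suc n) x - f n x\<bar> \<partial>unit_leb)"
    by (rule nn_integral_suminf) measurable
  also have "\<dots> \<le> (\<Sum>n. ennreal (2 * (1/2) ^ n))"
    by (intro suminf_le L1) auto
  also have "\<dots> < \<infinity>"
    by (subst suminf_ennreal2) (auto intro!: summable_mult)
  finally have fin: "(\<integral>\<^sup>+x. (\<Sum>n. ennreal \<bar>f (Suc n) x - f n x\<bar>) \<partial>unit_leb) \<noteq> \<infinity>"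
    by (rule less_imp_neq)
  have "(\<lambda>x. \<Sum>n. ennreal \<bar>f (Suc n) x - f n x\<bar>) \<in> borel_measurable unit_leb"
    by measurable
  from nn_integral_PInf_AE[OF this fin]
  have "AE x in unit_leb. (\<Sum>n. ennreal \<bar>f (Suc n) x - f n x\<bar>) \<noteq> \<infinity>" .
  then have conv: "AE x in unit_leb. (\<lambda>n. f n x) \<longlonglongrightarrow> F x"
  proof eventually_elim
    case (elim x)
    have "summable (\<lambda>n. \<bar>f (Suc n) x - f n x\<bar>)"
      using elim by (intro summable_suminf_not_top) auto
    then have "summable (\<lambda>n. f (Suc n) x - f n x)"
      by (rule summable_rabs_cancel)
    then have "convergent (\<lambda>N. \<Sum>n<N. f (Suc n) x - f n x)"
      by (simp add: summable_iff_convergent)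
    moreover have "(\<Sum>n<N. f (Suc n) x - f n x) = f N x - f 0 x" for N
      by (rule sum_lessThan_telescope)
    ultimately have "convergent (\<lambda>N. f N x - f 0 x)"
      by simp
    then have "convergent (\<lambda>N. (f N x - f 0 x) + f 0 x)"
      by (intro convergent_add) (auto simp: convergent_const)
    then show ?case
      by (simp add: F_def convergent_LIMSEQ_iff)
  qed
  have fatou: "(\<integral>\<^sup>+x. ennreal ((F x - f m x)\<^sup>2) \<partial>unit_leb) \<le> ennreal ((1/4) ^ m)" for m
  proof -
    have "(\<integral>\<^sup>+x. ennreal ((F x - f m x)\<^sup>2) \<partial>unit_leb)
        = (\<integral>\<^sup>+x. liminf (\<lambda>n. ennreal ((f n x - f m x)\<^sup>2)) \<partial>unit_leb)"
    proof (rule nn_integral_cong_AE, use conv in eventually_elim)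
      case (elim x)
      then have "(\<lambda>n. ennreal ((f n x - f m x)\<^sup>2)) \<longlonglongrightarrow> ennreal ((F x - f m x)\<^sup>2)"
        by (intro tendsto_ennrealI tendsto_intros)
      then show ?case
        by (rule lim_imp_Liminf[OF sequentially_bot, symmetric])
    qed
    also have "\<dots> \<le> liminf (\<lambda>n. \<integral>\<^sup>+x. ennreal ((f n x - f m x)\<^sup>2) \<partial>unit_leb)"
      by (rule nn_integral_liminf) measurable
    also have "\<dots> \<le> liminf (\<lambda>n. ennreal ((1/4) ^ m))"
    proof (rule Liminf_mono, rule eventually_mono[OF eventually_ge_at_top[of m]])
      fix n assume "m \<le> n"
      then show "(\<integral>\<^sup>+x. ennreal ((f n x - f m x)\<^sup>2) \<partial>unit_leb) \<le> ennreal ((1/4) ^ m)"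
        using le int by (subst nn_integral_eq_integral) (auto intro!: ennreal_leI)
    qed
    also have "\<dots> = ennreal ((1/4) ^ m)"
      by (simp add: Liminf_const)
    finally show ?thesis .
  qed
  have intF: "integrable unit_leb (\<lambda>x. (F x - f m x)\<^sup>2)" for m
  proof (rule integrableI_nonneg)
    show "(\<integral>\<^sup>+x. ennreal ((F x - f m x)\<^sup>2) \<partial>unit_leb) < \<infinity>"
      using fatou[of m] by (rule le_less_trans) simp
  qed auto
  have sqF: "square_integrable F"
  proof -
    have "square_integrable (\<lambda>x. F x - f 0 x)"
      using intF by (simp add: square_integrable_def)
    from square_integrable_add[OF this f[of 0]] show ?thesis by simp
  qed
  have "dist (abs_l2 (f m)) (abs_l2 F) \<le> (1/2) ^ m" for m
  proof -
    have "ennreal (LINT x|unit_leb. (F x - f m x)\<^sup>2) \<le> ennreal ((1/4) ^ m)"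
      using fatou[of m] intF by (subst (asm) nn_integral_eq_integral) auto
    then have "(LINT x|unit_leb. (F x - f m x)\<^sup>2) \<le> ((1/2) ^ m)\<^sup>2"
      by (simp add: half_power_sq)
    then have "dist (abs_l2 F) (abs_l2 (f m)) \<le> (1/2) ^ m"
      by (simp add: dist_abs_l2(2)[OF sqF f] real_le_lsqrt)
    then show ?thesis by (simp add: dist_commute)
  qed
  then have "\<forall>\<^sub>F n in sequentially. norm (dist (abs_l2 (f n)) (abs_l2 F)) \<le> (1/2) ^ n"
    by simp
  moreover have "(\<lambda>n. (1/2) ^ n :: real) \<longlonglongrightarrow> 0"
    by (rule LIMSEQ_power_zero) simp
  ultimately have "(\<lambda>n. dist (abs_l2 (f n)) (abs_l2 F)) \<longlonglongrightarrow> 0"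
    by (rule Lim_null_comparison)
  then have "(\<lambda>n. abs_l2 (f n)) \<longlonglongrightarrow> abs_l2 F"
    by (subst tendsto_dist_iff)
  then show ?thesis by (rule convergentI)
qed

instance l2 :: complete_space
proof
  fix X :: "nat \<Rightarrow> l2"
  assume X: "Cauchy X"
  have step: "\<exists>k>j. \<forall>m\<ge>k. dist (X m) (X k) < (1/2) ^ n" for j n :: nat
  proof -
    obtain M where M: "dist (X m) (X n') < (1/2) ^ n" if "m \<ge> M" "n' \<ge> M" for m n'
      using metric_CauchyD[OF X, of "(1/2) ^ n"] by auto
    then show ?thesis
      by (intro exI[of _ "max M (Suc j)"]) auto
  qed
  have "\<exists>r. \<forall>n. (\<forall>m\<ge>r n. dist (X m) (X (r n)) < (1/2) ^ n) \<and> r n < r (Suc n)"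
  proof (rule dependent_nat_choice)
    show "\<exists>k. \<forall>m\<ge>k. dist (X m) (X k) < (1/2) ^ 0"
      using step[of 0 0] by blast
    show "\<exists>k. (\<forall>m\<ge>k. dist (X m) (X k) < (1/2) ^ Suc n) \<and> j < k" for j n
      using step[of j "Suc n"] by blast
  qed
  then obtain r where r: "\<And>n m. m \<ge> r n \<Longrightarrow> dist (X m) (X (r n)) < (1/2) ^ n"
    and "\<And>n. r n < r (Suc n)"
    by blast
  then have mono: "strict_mono r"
    by (simp add: strict_mono_Suc_iff)
  have "\<exists>f. square_integrable f \<and> X (r n) = abs_l2 f" for n
    by (rule l2_cases[of "X (r n)"]) blast
  then have "\<exists>f. \<forall>n. square_integrable (f n) \<and> X (r n) = abs_l2 (f n)"
    by (intro choice) simp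
  then obtain f where f: "\<And>n. square_integrable (f n)" "\<And>n. X (r n) = abs_l2 (f n)"
    by blast
  have "convergent (\<lambda>n. abs_l2 (f n))"
  proof (rule abs_l2_fast_Cauchy_convergent)
    show "dist (abs_l2 (f n)) (abs_l2 (f m)) \<le> (1/2) ^ m" if "m \<le> n" for m n
      using r[of m "r n"] that mono by (simp add: f(2)[symmetric] strict_mono_less_eq less_imp_le)
  qed (rule f)
  then obtain L where "(X \<circ> r) \<longlonglongrightarrow> L"
    by (auto simp: convergent_def f comp_def)
  then show "convergent X"
    using X mono Cauchy_converges_subseq[of X r L] by (auto simp: convergent_def)
qed

section \<open>Weak derivatives\<close>

text \<open>Test functions are smooth functions with compact support in the interior of the unit
  interval; a closed support contained in the open interval is automatically compact.\<close>

definition test_function :: "(real \<Rightarrow> real) \<Rightarrow> bool" where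
  "test_function \<phi> \<longleftrightarrow>
     (\<forall>n x. ((deriv ^^ n) \<phi>) differentiable (at x)) \<and> closure {x. \<phi> x \<noteq> 0} \<subseteq> {0<..<1}"

lemma test_function_measurable:
  assumes "test_function \<phi>"
  shows "\<phi> \<in> borel_measurable unit_leb" "deriv \<phi> \<in> borel_measurable unit_leb"
proof -
  have "((deriv ^^ n) \<phi>) \<in> borel_measurable unit_leb" for n
  proof -
    have "continuous_on {0..1} ((deriv ^^ n) \<phi>)"
      using assms unfolding test_function_def
      by (intro continuous_at_imp_continuous_on) (auto intro: differentiable_imp_continuous_within)
    then show ?thesis
      by (rule continuous_imp_measurable_on_sets_lebesgue) simp
  qed
  from this[of 0] this[of 1]
  show "\<phi> \<in> borel_measurable unit_leb" "deriv \<phi> \<in> borel_measurable unit_leb"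
    by simp_all
qed

lemma l2_eq_integral_cong:
  assumes "l2_eq f g" "h \<in> borel_measurable unit_leb"
  shows "(LINT x|unit_leb. f x * h x) = (LINT x|unit_leb. g x * h x)"
  using assms
  by (intro integral_cong_AE) (auto simp: l2_eq_def square_integrable_def elim: AE_mp)

lift_definition has_weak_derivative :: "l2 \<Rightarrow> l2 \<Rightarrow> bool" is
  "\<lambda>f g. \<forall>\<phi>. test_function \<phi> \<longrightarrow>
     (LINT x|unit_leb. f x * deriv \<phi> x) = - (LINT x|unit_leb. g x * \<phi> x)"
  by (auto simp: l2_eq_integral_cong test_function_measurable)

text \<open>A weak derivative is unique as an element of \<open>l2\<close>. On elements without a weak
  derivative the value below is unspecified, so membership in \<open>W12\<close> and \<open>A2\<close> is
  stated with the relation.\<close>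

definition weak_deriv :: "l2 \<Rightarrow> l2" where
  "weak_deriv f = (THE g. has_weak_derivative f g)"

section \<open>Function spaces\<close>

definition W12 :: "l2 set" where
  "W12 = {f. \<exists>g. has_weak_derivative f g}"

lift_definition represents :: "(real \<Rightarrow> real) \<Rightarrow> l2 \<Rightarrow> bool" is
  "\<lambda>u f. AE x in unit_leb. u x = f x"
  by (auto simp: l2_eq_def elim: AE_mp)

text \<open>Vanishing trace: the continuous representative on the closed interval, which is unique,
  vanishes at both end points.\<close>

definition W12_0 :: "l2 set" where
  "W12_0 = {f \<in> W12. \<exists>u. continuous_on {0..1} u \<and> represents u f \<and> u 0 = 0 \<and> u 1 = 0}"

definition A2 :: "l2 set" where
  "A2 = {g. has_weak_derivative g 0}"

end

theory Submission
  imports Defs "HOL-Computational_Algebra.Polynomial"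
begin

text \<open>By the du Bois-Reymond lemma the first summand consists of the constants. The second one is
  the orthogonal complement of the constants: an element of \<open>W12_0\<close> with weak derivative \<open>\<eta>\<close>
  differs from the primitive \<open>x \<mapsto> \<integral>\<^sub>0\<^sup>x \<eta>\<close> by a constant, so its vanishing boundary values force \<open>\<eta>\<close>
  to have integral zero, and conversely the primitive of a function with integral zero vanishes at
  both end points. Thus the decomposition splits off the mean value.\<close>

section \<open>Smooth bump functions\<close>

text \<open>A test function must be infinitely differentiable with support away from both end
  points, so the du Bois-Reymond lemma needs a supply of such functions. They are built from
  exp(-s/((x - a)(b - x))), and the only delicate points are \<open>a\<close> and \<open>b\<close>,
  where the exponential decay has to absorb the poles created by differentiation. The resulting
  fundamental lemma acts three times: it yields a test function with nonzero integral, it closes the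
  du Bois-Reymond argument, and it makes weak derivatives unique, which gives the description by
  \<open>THE\<close> in \<open>weak_deriv\<close> its meaning. A square integrable function need not
  be continuous, so its primitive need not be differentiable everywhere; its weak derivative is
  therefore computed by Fubini on a triangle.\<close>

definition smooth :: "(real \<Rightarrow> real) \<Rightarrow> bool" where
  "smooth f \<longleftrightarrow> (\<forall>n x. ((deriv ^^ n) f) differentiable (at x))"

text \<open>Iterates of \<open>deriv\<close> never leave a class that contains a derivative of each
  of its members. An invariant \<open>P\<close> thus replaces any formula for the n-th
  derivative.\<close>

lemma smooth_coinduct:
  assumes "P f"
    and step: "\<And>f. P f \<Longrightarrow> \<exists>f'. P f' \<and> (\<forall>x. (f has_real_derivative f' x) (at x))"
  shows "smooth f"
proof -
  have deriv: "P (deriv g)" if pg: "P g" for g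
  proof -
    obtain g' where g': "P g'" "\<And>x. (g has_real_derivative g' x) (at x)"
      using step[OF pg] by blast
    then have "deriv g = g'"
      by (intro ext DERIV_imp_deriv)
    with g' show ?thesis by simp
  qed
  have "P ((deriv ^^ n) f)" for n
    by (induction n) (use assms(1) deriv in auto)
  then show ?thesis
    unfolding smooth_def using step by (meson real_differentiable_def)
qed

lemma smooth_has_derivative:
  assumes "smooth f"
  shows "(f has_real_derivative deriv f x) (at x)"
proof -
  have "((deriv ^^ 0) f) differentiable (at x)"
    using assms unfolding smooth_def by blast
  then show ?thesis
    by (metis DERIV_deriv_iff_real_differentiable funpow_0)
qed

lemma smooth_deriv: "smooth f \<Longrightarrow> smooth (deriv f)"
  unfolding smooth_def by (metis funpow_Suc_right o_apply)

lemma smooth_antiderivative: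
  assumes "smooth f" "\<And>x. (F has_real_derivative f x) (at x)"
  shows "smooth F"
proof (rule smooth_coinduct[where P = "\<lambda>g. g = F \<or> smooth g"])
  fix g assume "g = F \<or> smooth g"
  then show "\<exists>g'. (g' = F \<or> smooth g') \<and> (\<forall>x. (g has_real_derivative g' x) (at x))"
    using assms smooth_has_derivative smooth_deriv by blast
qed simp

lemma smooth_lincomb:
  assumes "smooth f" "smooth g"
  shows "smooth (\<lambda>x. c * f x + d * g x)"
proof (rule smooth_coinduct[where P = "\<lambda>h. \<exists>f g. smooth f \<and> smooth g \<and> h = (\<lambda>x. c * f x + d * g x)"])
  fix h assume "\<exists>f g. smooth f \<and> smooth g \<and> h = (\<lambda>x. c * f x + d * g x)"
  then obtain f g where h: "smooth f" "smooth g" "h = (\<lambda>x. c * f x + d * g x)"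
    by blast
  have "(h has_real_derivative c * deriv f x + d * deriv g x) (at x)" for x
    unfolding h(3) using smooth_has_derivative[OF h(1)] smooth_has_derivative[OF h(2)]
    by (auto intro!: derivative_eq_intros)
  then show "\<exists>h'. (\<exists>f g. smooth f \<and> smooth g \<and> h' = (\<lambda>x. c * f x + d * g x)) \<and>
      (\<forall>x. (h has_real_derivative h' x) (at x))"
    using h smooth_deriv by (intro exI[of _ "\<lambda>x. c * deriv f x + d * deriv g x"]) blast
qed (use assms in blast)

lemma smooth_continuous_on: "smooth f \<Longrightarrow> continuous_on S f"
  by (meson DERIV_isCont continuous_at_imp_continuous_on smooth_has_derivative)

text \<open>The bound forces \<open>f c = 0\<close> and dominates the difference quotient by
  \<open>C * \<bar>x - c\<bar>\<close>. This settles differentiability at the ends of the support of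
  a bump, where its two formulas meet.\<close>

lemma has_real_derivative_zero_if_quadratic_bound:
  fixes f :: "real \<Rightarrow> real"
  assumes "\<And>x. \<bar>f x\<bar> \<le> C * (x - c)\<^sup>2"
  shows "(f has_real_derivative 0) (at c)"
proof -
  have f0: "f c = 0" using assms[of c] by simp
  have "((\<lambda>x. (f x - f c) / (x - c)) \<longlongrightarrow> 0) (at c)"
  proof (rule Lim_null_comparison)
    show "\<forall>\<^sub>F x in at c. norm ((f x - f c) / (x - c)) \<le> C * \<bar>x - c\<bar>"
      unfolding eventually_at_filter
    proof (intro always_eventually allI impI)
      fix x assume x: "x \<noteq> c"
      have "\<bar>f x\<bar> \<le> C * \<bar>x - c\<bar> * \<bar>x - c\<bar>"
        using assms[of x] by (simp add: power2_eq_square mult.assoc)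
      then show "norm ((f x - f c) / (x - c)) \<le> C * \<bar>x - c\<bar>"
        using x by (simp add: f0 divide_le_eq)
    qed
    have "((\<lambda>x. C * \<bar>x - c\<bar>) \<longlongrightarrow> C * \<bar>c - c\<bar>) (at c)"
      by (intro tendsto_intros)
    then show "((\<lambda>x. C * \<bar>x - c\<bar>) \<longlongrightarrow> 0) (at c)" by simp
  qed
  then show ?thesis by (simp add: has_field_derivative_iff)
qed

text \<open>The family is closed under differentiation, which makes its members smooth; the bump
  functions are those with \<open>p = 1\<close> and \<open>n = 0\<close>.\<close>

definition bump_poly :: "real \<Rightarrow> real \<Rightarrow> real \<Rightarrow> real poly \<Rightarrow> nat \<Rightarrow> real \<Rightarrow> real" where
  "bump_poly s a b p n x = (if a < x \<and> x < b
     then poly p x / ((x - a) * (b - x)) ^ n * exp (- s / ((x - a) * (b - x))) else 0)"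

text \<open>With q = (x - a)(b - x), the factor exp(-s/q) is smaller than a multiple of any power of
  q, hence beats the pole of order \<open>n\<close>.\<close>

lemma bump_poly_quadratic_bound:
  assumes s: "s > 0"
  obtains C where "\<And>x. \<bar>bump_poly s a b p n x\<bar> \<le> C * ((x - a) * (b - x))\<^sup>2"
proof -
  obtain M where M: "\<And>x. x \<in> {a..b} \<Longrightarrow> \<bar>poly p x\<bar> \<le> M" and "M \<ge> 0"
  proof -
    have "compact (poly p ` {a..b})"
      by (intro compact_continuous_image) (auto intro!: continuous_intros)
    then obtain M where "\<forall>x\<in>poly p ` {a..b}. norm x \<le> M"
      using compact_imp_bounded bounded_iff by blast
    then show thesis
      by (intro that[of "max M 0"]) force+
  qed
  \<comment> \<open>Of the \<open>k\<close> powers of q gained from the exponential,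
    \<open>n\<close> cancel the denominator and two give the square.\<close>
  define k where "k = n + 2"
  show thesis
  proof (rule that[of "M * (real k / s) ^ k"])
    fix x :: real
    show "\<bar>bump_poly s a b p n x\<bar> \<le> M * (real k / s) ^ k * ((x - a) * (b - x))\<^sup>2"
    proof (cases "a < x \<and> x < b")
      case True
      define q where "q = (x - a) * (b - x)"
      have q: "q > 0" using True by (simp add: q_def)
      have k: "real k > 0" by (simp add: k_def)
      \<comment> \<open>Chosen so that \<open>exp y ^ k = exp (s / q)\<close>; raising y \<le> exp y
        to the power \<open>k\<close> then bounds the exponential.\<close>
      define y where "y = s / (real k * q)"
      have y: "y > 0" using q k s by (simp add: y_def)
      have "y ^ k \<le> exp y ^ k"
        using y exp_ge_add_one_self[of y] by (intro power_mono) linarith+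
      also have "\<dots> = exp (s / q)"
        using k by (simp add: exp_of_nat_mult[symmetric] y_def)
      finally have "exp (- s / q) \<le> 1 / y ^ k"
        using y by (simp add: exp_minus field_simps)
      also have "\<dots> = (real k / s) ^ k * q ^ k"
        by (simp add: y_def power_divide power_mult_distrib)
      finally have e: "exp (- s / q) \<le> (real k / s) ^ k * q ^ k" .
      have "\<bar>bump_poly s a b p n x\<bar> = \<bar>poly p x\<bar> / q ^ n * exp (- s / q)"
        using True q by (simp add: bump_poly_def q_def[symmetric] abs_mult power_abs)
      also have "\<dots> \<le> M / q ^ n * ((real k / s) ^ k * q ^ k)"
        using M[of x] True q e \<open>M \<ge> 0\<close> by (intro mult_mono divide_right_mono) auto
      also have "\<dots> = M * (real k / s) ^ k * q\<^sup>2"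
        using q unfolding k_def power_add by simp
      finally show ?thesis unfolding q_def .
    next
      case False
      then show ?thesis
        using \<open>M \<ge> 0\<close> s by (auto simp: bump_poly_def)
    qed
  qed
qed

text \<open>Inside the interval one of the two factors is the distance to \<open>c\<close> and the
  other is at most \<open>b - a\<close>; outside, the function is zero.\<close>

lemma bump_poly_quadratic_bound_endpoint:
  assumes "s > 0" "c = a \<or> c = b"
  obtains C where "\<And>x. \<bar>bump_poly s a b p n x\<bar> \<le> C * (x - c)\<^sup>2"
proof -
  obtain C where C: "\<And>x. \<bar>bump_poly s a b p n x\<bar> \<le> C * ((x - a) * (b - x))\<^sup>2"
    using bump_poly_quadratic_bound[OF assms(1)] by blast
  show thesis
  proof (rule that[of "\<bar>C\<bar> * (b - a)\<^sup>2"])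
    fix x :: real
    show "\<bar>bump_poly s a b p n x\<bar> \<le> \<bar>C\<bar> * (b - a)\<^sup>2 * (x - c)\<^sup>2"
    proof (cases "a < x \<and> x < b")
      case True
      have "(b - x)\<^sup>2 \<le> (b - a)\<^sup>2" "(x - a)\<^sup>2 \<le> (b - a)\<^sup>2"
        using True by (auto intro: power_mono)
      then have "((x - a) * (b - x))\<^sup>2 \<le> (b - a)\<^sup>2 * (x - c)\<^sup>2"
        using assms(2) mult_right_mono[of "(x - a)\<^sup>2" "(b - a)\<^sup>2" "(b - x)\<^sup>2"]
          mult_right_mono[of "(b - x)\<^sup>2" "(b - a)\<^sup>2" "(x - a)\<^sup>2"]
        by (auto simp: power_mult_distrib power2_commute[of x b] mult.commute)
      then have "C * ((x - a) * (b - x))\<^sup>2 \<le> \<bar>C\<bar> * ((b - a)\<^sup>2 * (x - c)\<^sup>2)"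
        by (intro mult_mono) auto
      with C[of x] show ?thesis by (simp add: mult.assoc)
    qed (auto simp: bump_poly_def)
  qed
qed

text \<open>Differentiating p q^(-n) exp(-s/q) gives the terms p' q^(-n), -n p q' q^(-n-1) and s p
  q' q^(-n-2), each times the exponential; the new polynomial is their numerator over the common
  denominator q^(n+2).\<close>

lemma bump_poly_deriv:
  fixes a b :: real
  defines "q \<equiv> [:-a, 1:] * [:b, -1:]"
  assumes s: "s > 0"
  shows "(bump_poly s a b p n has_real_derivative
    bump_poly s a b (pderiv p * q\<^sup>2 - smult (real n) (p * pderiv q * q) + smult s (p * pderiv q)) (n + 2) x) (at x)"
    (is "(_ has_real_derivative bump_poly s a b ?r _ x) _")
proof -
  have pq: "poly q y = (y - a) * (b - y)" for y
    by (simp add: q_def algebra_simps)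
  consider "x = a \<or> x = b" | "x < a \<or> b < x" | "a < x" "x < b" by linarith
  then show ?thesis
  proof cases
    case 1
    then obtain C where "\<And>y. \<bar>bump_poly s a b p n y\<bar> \<le> C * (y - x)\<^sup>2"
      using bump_poly_quadratic_bound_endpoint[OF s] by metis
    then have "(bump_poly s a b p n has_real_derivative 0) (at x)"
      by (rule has_real_derivative_zero_if_quadratic_bound)
    moreover have "bump_poly s a b ?r (n + 2) x = 0"
      using 1 by (auto simp: bump_poly_def)
    ultimately show ?thesis by simp
  next
    case 2
    have "open ({..<a} \<union> {b<..})" by (intro open_Un) auto
    moreover have "bump_poly s a b p n y = 0" if "y \<in> {..<a} \<union> {b<..}" for y
      using that by (auto simp: bump_poly_def)
    ultimately have "(bump_poly s a b p n has_real_derivative 0) (at x)"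
      using 2 by (intro has_field_derivative_transform_within_open[OF DERIV_const]) auto
    moreover have "bump_poly s a b ?r (n + 2) x = 0"
      using 2 by (auto simp: bump_poly_def)
    ultimately show ?thesis by simp
  next
    case 3
    then have q0: "poly q x \<noteq> 0" by (simp add: pq)
    have "((\<lambda>y. poly p y / poly q y ^ n * exp (- s / poly q y)) has_real_derivative
        bump_poly s a b ?r (n + 2) x) (at x)"
    \<comment> \<open>The derivative of a power involves the predecessor of the exponent, which
      truncates at zero, so the exponent zero is treated apart.\<close>
    proof (cases n)
      case 0
      show ?thesis
        using q0 3 unfolding 0 bump_poly_def pq[symmetric]
        by (auto intro!: derivative_eq_intros simp: power2_eq_square field_simps)
    next
      case (Suc m)
      have "poly q x ^ m = poly q x * poly q x ^ (m - Suc 0)" if "0 < m"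
        using that by (cases m) auto
      then show ?thesis
        using q0 3 unfolding Suc bump_poly_def pq[symmetric]
        by (auto intro!: derivative_eq_intros simp: power2_eq_square field_simps)
    qed
    then show ?thesis
      using 3 by (elim has_field_derivative_transform_within_open[where S = "{a<..<b}"])
        (auto simp: bump_poly_def pq)
  qed
qed

lemma smooth_bump_poly: "s > 0 \<Longrightarrow> smooth (bump_poly s a b p n)"
  by (rule smooth_coinduct[where P = "\<lambda>f. \<exists>p n. f = bump_poly s a b p n"])
    (use bump_poly_deriv in blast)+

definition bump :: "real \<Rightarrow> real \<Rightarrow> real \<Rightarrow> real \<Rightarrow> real" where
  "bump s a b x = (if a < x \<and> x < b then exp (- s / ((x - a) * (b - x))) else 0)"

lemma smooth_bump: "s > 0 \<Longrightarrow> smooth (bump s a b)"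
proof -
  have "bump s a b = bump_poly s a b 1 0"
    by (rule ext) (simp add: bump_def bump_poly_def)
  then show "s > 0 \<Longrightarrow> smooth (bump s a b)"
    by (simp add: smooth_bump_poly)
qed

lemma bump_bounds:
  assumes "s > 0"
  shows "0 \<le> bump s a b x" "bump s a b x \<le> 1"
  using assms by (auto simp: bump_def)

lemma test_functionI:
  assumes "smooth f" "0 < a" "b < 1" "\<And>x. x < a \<or> b < x \<Longrightarrow> f x = 0"
  shows "test_function f"
proof -
  have "closure {x. f x \<noteq> 0} \<subseteq> {a..b}"
    using assms(4) by (intro closure_minimal) (auto simp: not_less[symmetric])
  then show ?thesis
    using assms unfolding test_function_def smooth_def by force
qed

lemma test_function_bump: "s > 0 \<Longrightarrow> 0 < a \<Longrightarrow> b < 1 \<Longrightarrow> test_function (bump s a b)"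
  by (rule test_functionI[of _ a b]) (auto simp: smooth_bump, auto simp: bump_def)

section \<open>The fundamental lemma of the calculus of variations\<close>

text \<open>The positive and the negative part of \<open>g\<close> are densities of two measures
  that agree and are finite on all open right half-lines, hence are equal. Densities are unique
  almost everywhere, and a number whose positive and negative parts coincide is zero.\<close>

lemma AE_lborel_eq_0_if_integral_halfline_eq_0:
  fixes g :: "real \<Rightarrow> real"
  assumes g: "integrable lborel g"
    and zero: "\<And>a. (LINT x|lborel. g x * indicator {a<..} x) = 0"
  shows "AE x in lborel. g x = 0"
proof -
  have [measurable]: "g \<in> borel_measurable borel"
    using g by (simp add: borel_measurable_integrable)
  \<comment> \<open>Used with \<open>c\<close> equal to 1 and -1, for the two parts of
    \<open>g\<close>. Finiteness is also what allows equality of the \<open>enn2real\<close> values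
    to be lifted back to \<open>ennreal\<close>.\<close>
  have fin: "(\<integral>\<^sup>+x. ennreal (c * g x) * indicator A x \<partial>lborel) < \<infinity>" if "A \<in> sets borel" "\<bar>c\<bar> = 1" for c A
  proof -
    have "(\<integral>\<^sup>+x. ennreal (c * g x) * indicator A x \<partial>lborel) \<le> (\<integral>\<^sup>+x. ennreal (norm (g x)) \<partial>lborel)"
      using that by (intro nn_integral_mono) (auto simp: indicator_def abs_if split: if_splits intro!: ennreal_leI)
    also have "\<dots> < \<infinity>"
      using g by (simp add: integrable_iff_bounded)
    finally show ?thesis .
  qed
  have "density lborel (\<lambda>x. ennreal (g x)) = density lborel (\<lambda>x. ennreal (- g x))"
  proof (rule measure_eqI_lessThan)
    fix a :: real
    show "emeasure (density lborel (\<lambda>x. ennreal (g x))) {a<..} < \<infinity>"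
      using fin[of "{a<..}" 1] by (simp add: emeasure_density)
    have "integrable lborel (\<lambda>x. g x * indicator {a<..} x)"
      using integrable_mult_indicator[OF _ g, of "{a<..}"] by (simp add: mult.commute)
    then have "enn2real (\<integral>\<^sup>+x. ennreal (g x * indicator {a<..} x) \<partial>lborel)
        = enn2real (\<integral>\<^sup>+x. ennreal (- (g x * indicator {a<..} x)) \<partial>lborel)"
      using zero[of a] by (simp add: real_lebesgue_integral_def)
    moreover have "ennreal (c * (g x * indicator {a<..} x)) = ennreal (c * g x) * indicator {a<..} x" for c x
      by (simp add: indicator_def)
    from this[of 1] this[of "-1"]
    have "ennreal (g x * indicator {a<..} x) = ennreal (g x) * indicator {a<..} x"
      "ennreal (- (g x * indicator {a<..} x)) = ennreal (- g x) * indicator {a<..} x" for x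
      by simp_all
    ultimately have "enn2real (\<integral>\<^sup>+x. ennreal (g x) * indicator {a<..} x \<partial>lborel)
        = enn2real (\<integral>\<^sup>+x. ennreal (- g x) * indicator {a<..} x \<partial>lborel)"
      by simp
    then have "ennreal (enn2real (\<integral>\<^sup>+x. ennreal (g x) * indicator {a<..} x \<partial>lborel))
        = ennreal (enn2real (\<integral>\<^sup>+x. ennreal (- g x) * indicator {a<..} x \<partial>lborel))"
      by (rule arg_cong)
    then have "(\<integral>\<^sup>+x. ennreal (g x) * indicator {a<..} x \<partial>lborel)
        = (\<integral>\<^sup>+x. ennreal (- g x) * indicator {a<..} x \<partial>lborel)"
      using fin[of "{a<..}" 1] fin[of "{a<..}" "-1"]
      by (subst (asm) (1 2) ennreal_enn2real) simp_all
    then show "emeasure (density lborel (\<lambda>x. ennreal (g x))) {a<..}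
        = emeasure (density lborel (\<lambda>x. ennreal (- g x))) {a<..}"
      by (simp add: emeasure_density)
  qed simp_all
  then have "AE x in lborel. ennreal (g x) = ennreal (- g x)"
    by (rule sigma_finite_measure.density_unique[OF sigma_finite_lborel, rotated 2]) simp_all
  then show ?thesis
  proof eventually_elim
    case (elim x)
    then show ?case
      by (cases "0 \<le> g x") (simp_all add: ennreal_neg ennreal_eq_0_iff)
  qed
qed

text \<open>Reduction to Borel functions on the line: extend \<open>g\<close> by zero outside the
  open interval and pass to a Borel representative \<open>k\<close> of the extension.\<close>

lemma AE_unit_leb_eq_0_if_integral_interval_eq_0:
  fixes g :: "real \<Rightarrow> real"
  assumes g: "integrable unit_leb g"
    and zero: "\<And>a. 0 \<le> a \<Longrightarrow> a < 1 \<Longrightarrow> (LINT x|unit_leb. g x * indicator {a<..<1} x) = 0"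
  shows "AE x in unit_leb. g x = 0"
proof -
  define h where "h = (\<lambda>x. indicator {0<..<1} x * g x)"
  have "integrable unit_leb (\<lambda>x. indicator {0<..<1} x *\<^sub>R g x)"
    by (intro integrable_mult_indicator g) (auto simp: sets_restrict_space)
  then have h: "integrable lebesgue h"
    by (subst (asm) integrable_restrict_space)
      (auto simp: h_def indicator_def of_bool_def if_distrib cong: if_cong elim!: back_subst[where P = "integrable lebesgue"])
  have "h \<in> borel_measurable (completion lborel)"
    using h by (rule borel_measurable_integrable)
  then obtain k where k [measurable]: "k \<in> borel_measurable lborel" and hk: "AE x in lborel. h x = k x"
    using completion_ex_borel_measurable_real by blast
  have hk': "AE x in lebesgue. h x = k x"
    using hk by (rule AE_completion)
  have "integrable lebesgue k"
    by (rule integrable_cong_AE_imp[OF h]) (use hk' in \<open>auto intro: measurable_completion\<close>)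
  then have "integrable lborel k"
    by (simp add: integrable_completion)
  moreover have "(LINT x|lborel. k x * indicator {a<..} x) = 0" for a
  proof -
    have "(LINT x|lborel. k x * indicator {a<..} x) = (LINT x|lebesgue. k x * indicator {a<..} x)"
      by (rule integral_completion[symmetric]) simp
    also have "\<dots> = (LINT x|lebesgue. h x * indicator {a<..} x)"
      by (rule integral_cong_AE) (use hk' h in \<open>auto intro!: borel_measurable_times borel_measurable_indicator intro: measurable_completion\<close>)
    \<comment> \<open>A half-line meets the open unit interval in the interval from
      \<open>max 0 a\<close> to 1, which is empty if a \<ge> 1.\<close>
    also have "\<dots> = (LINT x|lebesgue. indicator {0..1} x *\<^sub>R (g x * indicator {max 0 a<..<1} x))"
      by (rule Bochner_Integration.integral_cong) (auto simp: h_def indicator_def)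
    also have "\<dots> = (LINT x|unit_leb. g x * indicator {max 0 a<..<1} x)"
      by (simp add: integral_restrict_space)
    also have "\<dots> = 0"
      using zero[of "max 0 a"] by (cases "a < 1") auto
    finally show ?thesis .
  qed
  ultimately have "AE x in lborel. k x = 0"
    by (rule AE_lborel_eq_0_if_integral_halfline_eq_0)
  then have "AE x in lebesgue. k x = 0"
    by (rule AE_completion)
  moreover have "AE x in lebesgue. x \<notin> {0, 1}"
    by (rule AE_not_in) (auto intro!: null_sets_completionI)
  ultimately have "AE x in lebesgue. x \<in> {0..1} \<longrightarrow> g x = 0"
    using hk' by eventually_elim (auto simp: h_def indicator_def split: if_splits)
  then show ?thesis
    by (simp add: AE_restrict_space_iff)
qed

section \<open>Testing integrable functions against smooth functions\<close>

lemma square_integrable_imp_integrable: "square_integrable f \<Longrightarrow> integrable unit_leb f"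
  using square_integrable_mult[of f "\<lambda>x. 1"]
  by (simp add: square_integrable_def continuous_imp_integrable_real)

lemma integrable_times_bounded:
  assumes f: "integrable unit_leb f" and h: "h \<in> borel_measurable unit_leb"
    and b: "\<And>x. x \<in> {0..1} \<Longrightarrow> \<bar>h x\<bar> \<le> (C::real)"
  shows "integrable unit_leb (\<lambda>x. f x * h x)"
proof (rule Bochner_Integration.integrable_bound)
  show "integrable unit_leb (\<lambda>x. C * f x)" using f by simp
  show "(\<lambda>x. f x * h x) \<in> borel_measurable unit_leb"
    using borel_measurable_integrable[OF f] h by (rule borel_measurable_times)
  have "\<bar>f x * h x\<bar> \<le> \<bar>C * f x\<bar>" if "x \<in> {0..1}" for x
    using b[OF that] by (simp add: abs_mult mult.commute[of "\<bar>f x\<bar>"] mult_right_mono)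
  then show "AE x in unit_leb. norm (f x * h x) \<le> norm (C * f x)"
    by (intro AE_I2) simp
qed

lemma integrable_times_test_function:
  assumes "integrable unit_leb f" "test_function \<phi>"
  shows "integrable unit_leb (\<lambda>x. f x * \<phi> x)"
proof -
  have "continuous_on {0..1} \<phi>"
    using assms(2) smooth_continuous_on by (auto simp: test_function_def smooth_def)
  then have "compact (\<phi> ` {0..1})"
    by (intro compact_continuous_image) auto
  then obtain C where "\<forall>y\<in>\<phi> ` {0..1}. norm y \<le> C"
    using compact_imp_bounded bounded_iff by blast
  then show ?thesis
    using assms test_function_measurable by (intro integrable_times_bounded) auto
qed

text \<open>Shrinking the support slightly while letting the parameter \<open>s\<close> tend to zero turns the
  bump functions into the indicator of an interval that may touch the boundary.\<close>

lemma bump_tendsto_indicator: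
  "(\<lambda>n. bump (1 / real (Suc n)) (a + 1 / real (Suc n)) (b - 1 / real (Suc n)) x)
    \<longlonglongrightarrow> indicator {a<..<b} x"
proof (cases "a < x \<and> x < b")
  case True
  have l: "(\<lambda>n. 1 / real (Suc n)) \<longlonglongrightarrow> 0"
    by (rule LIMSEQ_Suc[OF lim_1_over_n])
  have la: "(\<lambda>n. a + 1 / real (Suc n)) \<longlonglongrightarrow> a" and lb: "(\<lambda>n. b - 1 / real (Suc n)) \<longlonglongrightarrow> b"
    using tendsto_add[OF tendsto_const l, of a] tendsto_diff[OF tendsto_const l, of b] by simp_all
  have "\<forall>\<^sub>F n in sequentially. a + 1 / real (Suc n) < x \<and> x < b - 1 / real (Suc n)"
    using order_tendstoD(2)[OF la, of x] order_tendstoD(1)[OF lb, of x] True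
    by (auto intro: eventually_conj)
  then have "\<forall>\<^sub>F n in sequentially.
      exp (- (1 / real (Suc n)) / ((x - (a + 1 / real (Suc n))) * ((b - 1 / real (Suc n)) - x)))
      = bump (1 / real (Suc n)) (a + 1 / real (Suc n)) (b - 1 / real (Suc n)) x"
    by eventually_elim (simp add: bump_def)
  moreover have "(\<lambda>n. exp (- (1 / real (Suc n)) / ((x - (a + 1 / real (Suc n))) * ((b - 1 / real (Suc n)) - x))))
      \<longlonglongrightarrow> exp (- 0 / ((x - a) * (b - x)))"
    using True by (intro tendsto_intros l la lb) auto
  ultimately show ?thesis
    using True by (auto intro: Lim_transform_eventually)
next
  case False
  have "bump (1 / real (Suc n)) (a + 1 / real (Suc n)) (b - 1 / real (Suc n)) x = 0" for n
  proof -
    have "1 / real (Suc n) > 0" by simp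
    then have "\<not> (a + 1 / real (Suc n) < x \<and> x < b - 1 / real (Suc n))"
      using False by linarith
    then show ?thesis by (simp only: bump_def if_False)
  qed
  then show ?thesis using False by simp
qed

text \<open>Bumps bounded by 1 converge pointwise to the indicator of each interval from
  \<open>a\<close> to 1, so dominated convergence with majorant \<bar>g\<bar> carries the hypothesis
  over to these indicators.\<close>

lemma fundamental_lemma:
  assumes g: "integrable unit_leb g"
    and zero: "\<And>\<phi>. test_function \<phi> \<Longrightarrow> (LINT x|unit_leb. g x * \<phi> x) = 0"
  shows "AE x in unit_leb. g x = 0"
proof (rule AE_unit_leb_eq_0_if_integral_interval_eq_0[OF g])
  fix a :: real assume a: "0 \<le> a" "a < 1"
  \<comment> \<open>For small \<open>n\<close> the interval may be empty; then \<open>B n\<close> is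
    zero, which is still a test function.\<close>
  define B where "B n = bump (1 / real (Suc n)) (a + 1 / real (Suc n)) (1 - 1 / real (Suc n))" for n
  have pos: "1 / real (Suc n) > 0" for n by simp
  have test: "test_function (B n)" for n
    using a pos[of n] unfolding B_def by (intro test_function_bump) linarith+
  have [measurable]: "g \<in> borel_measurable unit_leb"
    using g by (rule borel_measurable_integrable)
  have [measurable]: "B n \<in> borel_measurable unit_leb" for n
    by (rule test_function_measurable[OF test])
  have "(\<lambda>n. LINT x|unit_leb. g x * B n x) \<longlonglongrightarrow> (LINT x|unit_leb. g x * indicator {a<..<1} x)"
  proof (rule integral_dominated_convergence[where w = "\<lambda>x. \<bar>g x\<bar>"])
    show "(\<lambda>x. g x * indicator {a<..<1} x) \<in> borel_measurable unit_leb"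
      using a by (intro borel_measurable_times borel_measurable_indicator)
        (auto simp: sets_restrict_space intro!: image_eqI[of _ _ "{a<..<1}"])
    show "AE x in unit_leb. (\<lambda>n. g x * B n x) \<longlonglongrightarrow> g x * indicator {a<..<1} x"
      unfolding B_def by (intro AE_I2 tendsto_mult tendsto_const bump_tendsto_indicator)
    show "AE x in unit_leb. norm (g x * B n x) \<le> \<bar>g x\<bar>" for n
      unfolding B_def using bump_bounds[OF pos[of n]]
      by (intro AE_I2) (auto simp: abs_mult intro!: mult_left_le)
  qed (use g in auto)
  then show "(LINT x|unit_leb. g x * indicator {a<..<1} x) = 0"
    using zero[OF test] by (simp add: LIMSEQ_const_iff)
qed

section \<open>Antiderivatives of test functions and the du Bois-Reymond lemma\<close>

lemma test_function_iff_smooth: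
  "test_function \<phi> \<longleftrightarrow> smooth \<phi> \<and> closure {x. \<phi> x \<noteq> 0} \<subseteq> {0<..<1}"
  by (simp add: test_function_def smooth_def)

lemma test_function_support:
  assumes "test_function \<phi>"
  obtains a b where "0 < a" "a \<le> b" "b < 1" "\<And>x. x < a \<or> b < x \<Longrightarrow> \<phi> x = 0"
proof -
  \<comment> \<open>The point 1/2 keeps \<open>K\<close> nonempty when \<open>\<phi>\<close>
    vanishes identically, so that its extrema \<open>a\<close> and \<open>b\<close> exist.\<close>
  define K where "K = insert (1/2) (closure {x. \<phi> x \<noteq> 0})"
  have K: "K \<subseteq> {0<..<1}" "K \<noteq> {}" "closed K"
    using assms by (auto simp: K_def test_function_def)
  then have "compact K"
    using bounded_subset[OF compact_imp_bounded[OF compact_Icc], of K 0 1]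
    by (force simp: compact_eq_bounded_closed)
  then obtain a b where ab: "a \<in> K" "\<And>x. x \<in> K \<Longrightarrow> a \<le> x" "b \<in> K" "\<And>x. x \<in> K \<Longrightarrow> x \<le> b"
    using compact_attains_inf compact_attains_sup K(2) by metis
  have "\<phi> x = 0" if "x < a \<or> b < x" for x
  proof (rule ccontr)
    assume "\<phi> x \<noteq> 0"
    then have "x \<in> K" using closure_subset[of "{x. \<phi> x \<noteq> 0}"] by (auto simp: K_def)
    with ab that show False by force
  qed
  with ab K(1) show thesis
    by (intro that[of a b]) auto
qed

lemma test_function_lincomb:
  assumes "test_function \<phi>" "test_function \<psi>"
  shows "test_function (\<lambda>x. c * \<phi> x + d * \<psi> x)"
proof -
  have "closure {x. c * \<phi> x + d * \<psi> x \<noteq> 0} \<subseteq> closure ({x. \<phi> x \<noteq> 0} \<union> {x. \<psi> x \<noteq> 0})"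
    by (intro closure_mono) auto
  then show ?thesis
    using assms smooth_lincomb unfolding test_function_iff_smooth closure_Un by blast
qed

text \<open>The cut-off at \<open>a\<close> is the shape of the inner integral once Fubini has been
  applied in \<open>weak_derivative_primitive\<close>.\<close>

lemma LINT_unit_leb_deriv:
  assumes "smooth \<phi>" "0 \<le> a" "a \<le> 1"
  shows "(LINT x|unit_leb. deriv \<phi> x * indicator {a..} x) = \<phi> 1 - \<phi> a"
proof -
  have cont: "continuous_on {a..1} (deriv \<phi>)"
    using assms(1) smooth_continuous_on smooth_deriv by blast
  have "(LINT x|unit_leb. deriv \<phi> x * indicator {a..} x)
      = (LINT x|lebesgue. indicator {0..1} x *\<^sub>R (deriv \<phi> x * indicator {a..} x))"
    by (simp add: integral_restrict_space)
  also have "\<dots> = (LINT x|lebesgue. indicator {a..1} x *\<^sub>R deriv \<phi> x)"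
    using assms by (intro Bochner_Integration.integral_cong) (auto simp: indicator_def)
  also have "\<dots> = (LINT x|lebesgue_on {a..1}. deriv \<phi> x)"
    by (simp add: integral_restrict_space)
  also have "\<dots> = integral {a..1} (deriv \<phi>)"
    using cont by (simp add: lebesgue_integral_eq_integral continuous_imp_integrable_real)
  also have "\<dots> = \<phi> 1 - \<phi> a"
    using assms smooth_has_derivative[OF assms(1)]
    by (intro integral_unique fundamental_theorem_of_calculus)
      (auto simp: has_real_derivative_iff_has_vector_derivative[symmetric] intro: DERIV_subset)
  finally show ?thesis .
qed

lemma LINT_unit_leb_deriv_full:
  assumes "smooth \<phi>"
  shows "(LINT x|unit_leb. deriv \<phi> x) = \<phi> 1 - \<phi> 0"
proof -
  have "(LINT x|unit_leb. deriv \<phi> x) = (LINT x|unit_leb. deriv \<phi> x * indicator {0..} x)"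
    by (intro Bochner_Integration.integral_cong) auto
  then show ?thesis using LINT_unit_leb_deriv[OF assms, of 0] by simp
qed

text \<open>Any primitive is constant on each side of the support of \<open>\<psi>\<close>.
  Normalising it at 0 kills the left constant; the right one is then the integral of
  \<open>\<psi>\<close>, which is zero.\<close>

lemma test_function_antiderivative:
  assumes "test_function \<psi>" "(LINT x|unit_leb. \<psi> x) = 0"
  obtains \<phi> where "test_function \<phi>" "deriv \<phi> = \<psi>"
proof -
  obtain a b where ab: "0 < a" "a \<le> b" "b < 1" and zero: "\<And>x. x < a \<or> b < x \<Longrightarrow> \<psi> x = 0"
    using test_function_support[OF assms(1)] by blast
  have smooth: "smooth \<psi>"
    using assms(1) by (simp add: test_function_iff_smooth)
  have "isCont \<psi> x" for x
    using smooth_has_derivative[OF smooth] by (rule DERIV_isCont)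
  then obtain F where "\<And>x. (F has_vector_derivative \<psi> x) (at x)"
    using einterval_antiderivative[of "-\<infinity>" \<infinity> \<psi>] by auto
  then have F: "(F has_real_derivative \<psi> x) (at x)" for x
    by (simp add: has_real_derivative_iff_has_vector_derivative)
  define \<phi> where "\<phi> = (\<lambda>x. F x - F 0)"
  have \<phi>: "(\<phi> has_real_derivative \<psi> x) (at x)" for x
    unfolding \<phi>_def using F[of x] by (auto intro!: derivative_eq_intros)
  have deriv: "deriv \<phi> = \<psi>"
    using \<phi> by (intro ext DERIV_imp_deriv)
  have smooth\<phi>: "smooth \<phi>"
    by (rule smooth_antiderivative[OF smooth \<phi>])
  have "\<phi> 0 = 0" by (simp add: \<phi>_def)
  moreover have "\<phi> 1 = 0"
    using LINT_unit_leb_deriv_full[OF smooth\<phi>] assms(2) \<open>\<phi> 0 = 0\<close> by (simp add: deriv)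
  moreover have "\<phi> x = \<phi> y" if "x < a \<and> y < a \<or> b < x \<and> b < y" for x y
  proof -
    have "\<phi> u = \<phi> v" if "u < v" "v < a \<or> b < u" for u v
    proof -
      have "\<exists>z. u < z \<and> z < v \<and> \<phi> v - \<phi> u = (v - u) * \<psi> z"
        using MVT2[OF \<open>u < v\<close>] \<phi> by blast
      then show ?thesis using zero that by force
    qed
    then show ?thesis using that by (metis linorder_neqE)
  qed
  ultimately have "\<phi> x = 0" if "x < a \<or> b < x" for x
    using that ab by metis
  then have "test_function \<phi>"
    using smooth\<phi> ab by (intro test_functionI[of \<phi> a b]) auto
  with deriv show thesis by (intro that)
qed

text \<open>Fix a test function \<open>\<psi>\<close> with integral \<open>I \<noteq> 0\<close>. For
  a test function \<open>\<phi>\<close> with integral \<open>J\<close>, the combination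
  \<open>I * \<phi> - J * \<psi>\<close> has integral zero, hence is the derivative of a test
  function and is annihilated by \<open>f\<close>. This says that \<open>f - c\<close> annihilates
  \<open>\<phi>\<close>, where \<open>c\<close> is the ratio of the integrals of
  \<open>f * \<psi>\<close> and \<open>\<psi>\<close>.\<close>

lemma du_Bois_Reymond:
  assumes f: "integrable unit_leb f"
    and zero: "\<And>\<phi>. test_function \<phi> \<Longrightarrow> (LINT x|unit_leb. f x * deriv \<phi> x) = 0"
  obtains c where "AE x in unit_leb. f x = c"
proof -
  have one: "integrable unit_leb (\<lambda>x. 1 :: real)"
    by (intro continuous_imp_integrable_real continuous_intros)
  \<comment> \<open>If every test function had integral zero, the fundamental lemma would make the
    constant 1 vanish almost everywhere.\<close>
  obtain \<psi> where \<psi>: "test_function \<psi>" "(LINT x|unit_leb. \<psi> x) \<noteq> 0"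
  proof (rule ccontr)
    assume "\<not> thesis"
    then have "\<And>\<phi>. test_function \<phi> \<Longrightarrow> (LINT x|unit_leb. 1 * \<phi> x) = 0"
      using that by auto
    then have "AE x in unit_leb. (1::real) = 0"
      by (rule fundamental_lemma[OF one])
    then have "(LINT x|unit_leb. 1::real) = 0"
      by (rule integral_eq_zero_AE)
    then show False by (simp add: measure_restrict_space)
  qed
  define I where "I = (LINT x|unit_leb. \<psi> x)"
  define c where "c = (LINT x|unit_leb. f x * \<psi> x) / I"
  have I: "I \<noteq> 0" using \<psi>(2) by (simp add: I_def)
  have int1: "integrable unit_leb \<phi>" if "test_function \<phi>" for \<phi>
    using integrable_times_test_function[OF one that] by simp
  have int: "integrable unit_leb (\<lambda>x. f x * \<phi> x)" if "test_function \<phi>" for \<phi>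
    using integrable_times_test_function[OF f that] .
  have "AE x in unit_leb. f x - c = 0"
  proof (rule fundamental_lemma)
    show "integrable unit_leb (\<lambda>x. f x - c)"
      using f one integrable_mult_right[OF one, of c] by (intro Bochner_Integration.integrable_diff) auto
    fix \<phi> assume \<phi>: "test_function \<phi>"
    define J where "J = (LINT x|unit_leb. \<phi> x)"
    have "(LINT x|unit_leb. I * \<phi> x + (- J) * \<psi> x) = 0"
      using int1[OF \<phi>] int1[OF \<psi>(1)] by (simp add: I_def J_def)
    with test_function_lincomb[OF \<phi> \<psi>(1)] obtain \<theta>
      where \<theta>: "test_function \<theta>" "deriv \<theta> = (\<lambda>x. I * \<phi> x + (- J) * \<psi> x)"
      by (rule test_function_antiderivative)
    have "0 = (LINT x|unit_leb. I * (f x * \<phi> x) - J * (f x * \<psi> x))"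
      using zero[OF \<theta>(1)] by (simp add: \<theta>(2) algebra_simps)
    also have "\<dots> = I * (LINT x|unit_leb. f x * \<phi> x) - J * (c * I)"
      using int[OF \<phi>] int[OF \<psi>(1)] I by (simp add: c_def)
    finally have "(LINT x|unit_leb. f x * \<phi> x) = c * J"
      using I by (simp add: field_simps)
    moreover have "(LINT x|unit_leb. (f x - c) * \<phi> x) = (LINT x|unit_leb. f x * \<phi> x) - c * J"
      using int[OF \<phi>] int1[OF \<phi>] by (simp add: left_diff_distrib J_def)
    ultimately show "(LINT x|unit_leb. (f x - c) * \<phi> x) = 0" by simp
  qed
  then show thesis by (intro that[of c]) simp
qed

section \<open>Primitives of square integrable functions\<close>

definition primitive :: "(real \<Rightarrow> real) \<Rightarrow> real \<Rightarrow> real" where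
  "primitive g x = (LINT t|lebesgue_on {0..x}. g t)"

text \<open>The condition t \<le> x is written as an indicator in \<open>x\<close>, so that the same
  integrand can be integrated first over \<open>t\<close> or first over \<open>x\<close>.\<close>

lemma primitive_eq:
  assumes "x \<in> {0..1}"
  shows "primitive g x = (LINT t|unit_leb. g t * indicator {t..} x)"
proof -
  have "primitive g x = (LINT t|lebesgue. indicator {0..x} t *\<^sub>R g t)"
    by (simp add: primitive_def integral_restrict_space)
  also have "\<dots> = (LINT t|lebesgue. indicator {0..1} t *\<^sub>R (g t * indicator {t..} x))"
    using assms by (intro Bochner_Integration.integral_cong) (auto simp: indicator_def)
  finally show ?thesis by (simp add: integral_restrict_space)
qed

lemma primitive_0: "primitive g 0 = 0"
proof -
  have "{0..0::real} \<in> null_sets lebesgue" by (auto intro!: null_sets_completionI)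
  then show ?thesis unfolding primitive_def by (rule integral_eq_zero_null_sets)
qed

lemma continuous_on_primitive: "integrable unit_leb g \<Longrightarrow> continuous_on {0..1} (primitive g)"
  unfolding primitive_def by (rule indefinite_integral_continuous_real)

lemma square_integrable_continuous:
  assumes "continuous_on {0..1} u"
  shows "square_integrable u"
  unfolding square_integrable_def
  using assms by (auto intro!: continuous_imp_integrable_real continuous_intros
      continuous_imp_measurable_on_sets_lebesgue)

text \<open>Fubini for g(t) \<open>\<phi>\<close>'(x) on the triangle t \<le> x. Integrating over
  \<open>t\<close> first gives the left side; integrating over \<open>x\<close> first gives
  \<open>\<phi> 1 - \<phi> t\<close>, which is \<open>- \<phi> t\<close>.\<close>

lemma weak_derivative_primitive:
  assumes g: "integrable unit_leb g" and \<phi>: "test_function \<phi>"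
  shows "(LINT x|unit_leb. primitive g x * deriv \<phi> x) = - (LINT x|unit_leb. g x * \<phi> x)"
proof -
  have fin: "finite_measure unit_leb"
    by (rule finite_measure_lebesgue_on) simp
  interpret finite_measure unit_leb by (rule fin)
  interpret pair_sigma_finite unit_leb unit_leb ..
  have smooth: "smooth \<phi>" using \<phi> by (simp add: test_function_iff_smooth)
  have \<phi>1: "\<phi> 1 = 0" using test_function_support[OF \<phi>] by metis
  have [measurable]: "g \<in> borel_measurable unit_leb" "deriv \<phi> \<in> borel_measurable unit_leb"
    using g \<phi> test_function_measurable by auto
  have [measurable]: "(\<lambda>x. x) \<in> unit_leb \<rightarrow>\<^sub>M borel"
    by (intro continuous_imp_measurable_on_sets_lebesgue continuous_intros) simp
  have "compact (deriv \<phi> ` {0..1})"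
    using smooth by (intro compact_continuous_image smooth_continuous_on smooth_deriv) auto
  then obtain C where C: "\<And>x. x \<in> {0..1} \<Longrightarrow> \<bar>deriv \<phi> x\<bar> \<le> C"
    by (force dest: compact_imp_bounded simp: bounded_iff)
  define h where "h = (\<lambda>t x. g t * (deriv \<phi> x * indicator {t..} x))"
  \<comment> \<open>Joint measurability is visible only when the moving half-line is written as the
    comparison t \<le> x.\<close>
  have h_eq: "case_prod h = (\<lambda>(t, x). g t * (deriv \<phi> x * (if t \<le> x then 1 else 0)))"
    by (auto simp: h_def indicator_def)
  have "integrable (unit_leb \<Otimes>\<^sub>M unit_leb) (case_prod h)"
  proof (rule Bochner_Integration.integrable_bound)
    have "integrable (unit_leb \<Otimes>\<^sub>M unit_leb) (\<lambda>(t, x). g t * C)"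
      by (rule Fubini_integrable) (use g in auto)
    then show "integrable (unit_leb \<Otimes>\<^sub>M unit_leb) (\<lambda>p. g (fst p) * C)"
      by (simp add: case_prod_unfold)
    show "case_prod h \<in> borel_measurable (unit_leb \<Otimes>\<^sub>M unit_leb)"
      unfolding h_eq by measurable
    have "\<bar>h t x\<bar> \<le> \<bar>g t * C\<bar>" if "x \<in> {0..1}" for t x
      using C[OF that] by (auto simp: h_def abs_mult indicator_def intro!: mult_left_mono)
    then show "AE p in unit_leb \<Otimes>\<^sub>M unit_leb. norm (case_prod h p) \<le> norm (g (fst p) * C)"
      by (intro AE_I2) (auto simp: space_pair_measure)
  qed
  then have fubini: "(LINT x|unit_leb. LINT t|unit_leb. h t x) = (LINT t|unit_leb. LINT x|unit_leb. h t x)"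
    by (rule Fubini_integral)
  have inner: "(LINT t|unit_leb. h t x) = primitive g x * deriv \<phi> x" if "x \<in> {0..1}" for x
  proof -
    have "(LINT t|unit_leb. h t x) = (LINT t|unit_leb. (g t * indicator {t..} x) * deriv \<phi> x)"
      by (simp add: h_def mult_ac)
    then show ?thesis by (simp add: primitive_eq[OF that])
  qed
  have inner': "(LINT x|unit_leb. h t x) = - (g t * \<phi> t)" if "t \<in> {0..1}" for t
    using LINT_unit_leb_deriv[OF smooth, of t] that by (simp add: h_def \<phi>1)
  have "(LINT x|unit_leb. LINT t|unit_leb. h t x) = (LINT x|unit_leb. primitive g x * deriv \<phi> x)"
    by (rule Bochner_Integration.integral_cong) (simp_all add: inner)
  moreover have "(LINT t|unit_leb. LINT x|unit_leb. h t x) = (LINT t|unit_leb. - (g t * \<phi> t))"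
    by (rule Bochner_Integration.integral_cong) (simp_all add: inner')
  ultimately show ?thesis using fubini by simp
qed

section \<open>The weak derivative on square integrable functions\<close>

lemma l2_eq_refl: "square_integrable f \<Longrightarrow> l2_eq f f"
  by (simp add: l2_eq_def)

lemma abs_l2_eq_iff:
  "square_integrable f \<Longrightarrow> square_integrable g \<Longrightarrow>
    abs_l2 f = abs_l2 g \<longleftrightarrow> (AE x in unit_leb. f x = g x)"
  using Quotient3_rel[OF Quotient3_l2, of f g] by (auto simp: l2_eq_def)

lemma has_weak_derivative_abs_l2:
  "square_integrable f \<Longrightarrow> square_integrable g \<Longrightarrow>
    has_weak_derivative (abs_l2 f) (abs_l2 g) \<longleftrightarrow>
    (\<forall>\<phi>. test_function \<phi> \<longrightarrow> (LINT x|unit_leb. f x * deriv \<phi> x) = - (LINT x|unit_leb. g x * \<phi> x))"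
  by (simp add: has_weak_derivative.abs_eq l2_eq_refl)

lemma test_function_deriv: "test_function \<phi> \<Longrightarrow> test_function (deriv \<phi>)"
proof -
  assume \<phi>: "test_function \<phi>"
  then obtain a b where ab: "0 < a" "b < 1" and zero: "\<And>x. x < a \<or> b < x \<Longrightarrow> \<phi> x = 0"
    using test_function_support by metis
  have "deriv \<phi> x = 0" if "x < a \<or> b < x" for x
  proof (rule DERIV_imp_deriv, rule has_field_derivative_transform_within_open[OF DERIV_const[of 0]])
    show "open ({..<a} \<union> {b<..})" by (intro open_Un) auto
  qed (use that zero in auto)
  then show "test_function (deriv \<phi>)"
    using \<phi> ab by (intro test_functionI[of _ a b]) (auto simp: test_function_iff_smooth smooth_deriv)
qed

lemma has_weak_derivative_lincomb:
  assumes "has_weak_derivative f f'" "has_weak_derivative g g'"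
  shows "has_weak_derivative (c *\<^sub>R f + d *\<^sub>R g) (c *\<^sub>R f' + d *\<^sub>R g')"
proof -
  obtain u where u: "square_integrable u" "f = abs_l2 u" by (rule l2_cases)
  obtain u' where u': "square_integrable u'" "f' = abs_l2 u'" by (rule l2_cases)
  obtain v where v: "square_integrable v" "g = abs_l2 v" by (rule l2_cases)
  obtain v' where v': "square_integrable v'" "g' = abs_l2 v'" by (rule l2_cases)
  note sq = u(1) u'(1) v(1) v'(1) and eq = u(2) u'(2) v(2) v'(2)
  have int: "integrable unit_leb (\<lambda>x. w x * \<phi> x)" if "square_integrable w" "test_function \<phi>" for w \<phi>
    using that integrable_times_test_function square_integrable_imp_integrable by blast
  have comb: "c *\<^sub>R abs_l2 w + d *\<^sub>R abs_l2 z = abs_l2 (\<lambda>x. c * w x + d * z x)"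
    if "square_integrable w" "square_integrable z" for w z
    using that by (simp add: scaleR_l2.abs_eq plus_l2.abs_eq l2_eq_refl square_integrable_cmult)
  have lint: "(LINT x|unit_leb. (c * w x + d * z x) * \<phi> x)
      = c * (LINT x|unit_leb. w x * \<phi> x) + d * (LINT x|unit_leb. z x * \<phi> x)"
    if "square_integrable w" "square_integrable z" "test_function \<phi>" for w z \<phi>
    using int[OF that(1,3)] int[OF that(2,3)] by (simp add: distrib_right mult.assoc)
  show ?thesis
    using assms sq unfolding eq
    by (simp add: comb has_weak_derivative_abs_l2 square_integrable_add square_integrable_cmult
        lint test_function_deriv)
qed

text \<open>By linearity the difference \<open>g - h\<close> is a weak derivative of zero, so it
  annihilates every test function.\<close>

lemma has_weak_derivative_unique:
  assumes "has_weak_derivative f g" "has_weak_derivative f h"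
  shows "g = h"
proof -
  obtain k where k: "square_integrable k" "g - h = abs_l2 k"
    by (rule l2_cases)
  have "has_weak_derivative (1 *\<^sub>R f + (-1) *\<^sub>R f) (1 *\<^sub>R g + (-1) *\<^sub>R h)"
    using assms by (rule has_weak_derivative_lincomb)
  then have "has_weak_derivative (abs_l2 (\<lambda>x. 0)) (abs_l2 k)"
    using k by (simp add: zero_l2_def)
  then have "(LINT x|unit_leb. k x * \<phi> x) = 0" if "test_function \<phi>" for \<phi>
    using k that by (auto simp: has_weak_derivative_abs_l2 square_integrable_zero)
  then have "AE x in unit_leb. k x = 0"
    by (intro fundamental_lemma square_integrable_imp_integrable k)
  then have "abs_l2 k = abs_l2 (\<lambda>x. 0)"
    using k by (simp add: abs_l2_eq_iff square_integrable_zero)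
  then show ?thesis
    using k by (simp add: zero_l2_def[symmetric])
qed

lemma weak_deriv_eq: "has_weak_derivative f g \<Longrightarrow> weak_deriv f = g"
  unfolding weak_deriv_def using has_weak_derivative_unique by blast

section \<open>The two summands and the decomposition\<close>

definition const_l2 :: "real \<Rightarrow> l2" where
  "const_l2 c = abs_l2 (\<lambda>x. c)"

lemma square_integrable_const: "square_integrable (\<lambda>x. c)"
  by (simp add: square_integrable_continuous)

lemma const_l2_eq_scaleR: "const_l2 c = c *\<^sub>R const_l2 1"
  by (simp add: const_l2_def scaleR_l2.abs_eq l2_eq_refl square_integrable_const)

text \<open>The unit interval has measure 1, so the inner product with this unit vector is the mean
  value.\<close>

lemma inner_const_l2_one: "const_l2 1 \<bullet> const_l2 1 = 1"
  by (simp add: const_l2_def inner_l2.abs_eq l2_eq_refl square_integrable_const measure_restrict_space)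

lemma A2_eq: "A2 = range const_l2"
proof (intro subset_antisym subsetI)
  fix f assume "f \<in> A2"
  then have f: "has_weak_derivative f 0" by (simp add: A2_def)
  obtain u where u: "square_integrable u" "f = abs_l2 u"
    by (rule l2_cases)
  have "(LINT x|unit_leb. u x * deriv \<phi> x) = 0" if "test_function \<phi>" for \<phi>
    using f u that by (simp add: zero_l2_def has_weak_derivative_abs_l2 square_integrable_zero)
  then obtain c where "AE x in unit_leb. u x = c"
    using du_Bois_Reymond square_integrable_imp_integrable[OF u(1)] by metis
  then have "f = const_l2 c"
    using u by (simp add: const_l2_def abs_l2_eq_iff square_integrable_const)
  then show "f \<in> range const_l2" by blast
next
  fix f assume "f \<in> range const_l2"
  then obtain c where f: "f = const_l2 c" by blast
  have "(LINT x|unit_leb. c * deriv \<phi> x) = 0" if \<phi>: "test_function \<phi>" for \<phi>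
  proof -
    have "\<phi> 0 = 0" "\<phi> 1 = 0"
      using test_function_support[OF \<phi>] by metis+
    then show ?thesis
      using \<phi> LINT_unit_leb_deriv_full[of \<phi>] by (simp add: test_function_iff_smooth)
  qed
  then show "f \<in> A2"
    by (simp add: A2_def f const_l2_def zero_l2_def has_weak_derivative_abs_l2 square_integrable_zero
        square_integrable_const)
qed

lemma represents_abs_l2: "square_integrable f \<Longrightarrow> represents u (abs_l2 f) \<longleftrightarrow> (AE x in unit_leb. u x = f x)"
  by (simp add: represents.abs_eq l2_eq_refl)

text \<open>The end points form a null set, so equality of classes says nothing about them by
  itself; continuity of both functions carries it there. The square supplies a nonnegative
  continuous integrand with integral zero.\<close>

lemma continuous_on_AE_eq_imp_eq:
  fixes u v :: "real \<Rightarrow> real"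
  assumes "continuous_on {0..1} u" "continuous_on {0..1} v" "AE x in unit_leb. u x = v x" "x \<in> {0..1}"
  shows "u x = v x"
proof -
  have "(LINT x|unit_leb. (u x - v x)\<^sup>2) = 0"
    by (rule integral_eq_zero_AE) (use assms(3) in auto)
  then have "\<forall>x\<in>{0..1}. (u x - v x)\<^sup>2 = 0"
    using assms by (subst (asm) integralL_eq_0_iff) (auto intro!: continuous_intros)
  then show ?thesis using assms(4) by simp
qed

lemma has_weak_derivative_primitive:
  assumes "square_integrable g"
  shows "has_weak_derivative (abs_l2 (primitive g)) (abs_l2 g)"
  using assms weak_derivative_primitive square_integrable_imp_integrable
  by (simp add: has_weak_derivative_abs_l2 square_integrable_continuous continuous_on_primitive)

lemma weak_deriv_W12_0_eq: "weak_deriv ` W12_0 = {\<eta>. \<eta> \<bullet> const_l2 1 = 0}"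
proof -
  \<comment> \<open>Orthogonality to the constants thus becomes a boundary condition at 1 for the
    primitive.\<close>
  have inner1: "abs_l2 g \<bullet> const_l2 1 = primitive g 1" if "square_integrable g" for g
    using that by (simp add: const_l2_def inner_l2.abs_eq l2_eq_refl square_integrable_const primitive_def)
  show ?thesis
  proof (intro subset_antisym subsetI)
    fix \<eta> assume "\<eta> \<in> weak_deriv ` W12_0"
    then obtain f u where f: "has_weak_derivative f \<eta>"
      and u: "continuous_on {0..1} u" "represents u f" "u 0 = 0" "u 1 = 0"
      using weak_deriv_eq by (auto simp: W12_0_def W12_def)
    obtain g where g: "square_integrable g" "\<eta> = abs_l2 g"
      by (rule l2_cases)
    have G: "continuous_on {0..1} (primitive g)"
      using g by (simp add: continuous_on_primitive square_integrable_imp_integrable)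
    note sq = square_integrable_continuous[OF u(1)] square_integrable_continuous[OF G]
    obtain w where w: "square_integrable w" "f = abs_l2 w"
      by (rule l2_cases)
    have "f = abs_l2 u"
      using u(2) w sq by (auto simp: represents_abs_l2 abs_l2_eq_iff eq_commute)
    \<comment> \<open>Both \<open>f\<close> and the primitive of \<open>g\<close> have weak
      derivative \<open>\<eta>\<close>, so their difference lies in \<open>A2\<close>.\<close>
    moreover have "has_weak_derivative (1 *\<^sub>R f + (-1) *\<^sub>R abs_l2 (primitive g)) (1 *\<^sub>R \<eta> + (-1) *\<^sub>R \<eta>)"
      using f has_weak_derivative_primitive[OF g(1)] g(2) by (intro has_weak_derivative_lincomb) auto
    ultimately have "abs_l2 u - abs_l2 (primitive g) \<in> A2"
      by (simp add: A2_def)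
    then obtain c where "abs_l2 u - abs_l2 (primitive g) = const_l2 c"
      unfolding A2_eq by blast
    then have "abs_l2 u = abs_l2 (primitive g) + const_l2 c"
      by (simp add: algebra_simps)
    then have "abs_l2 u = abs_l2 (\<lambda>x. primitive g x + c)"
      using sq by (simp add: const_l2_def plus_l2.abs_eq l2_eq_refl square_integrable_const)
    then have "AE x in unit_leb. u x = primitive g x + c"
      using sq by (simp add: abs_l2_eq_iff square_integrable_add square_integrable_const)
    then have "u x = primitive g x + c" if "x \<in> {0..1}" for x
      using u(1) G that by (intro continuous_on_AE_eq_imp_eq) (auto intro!: continuous_intros)
    \<comment> \<open>At 0 both functions vanish, hence \<open>c = 0\<close>; evaluation at 1 then
      gives the claim.\<close>
    from this[of 0] this[of 1] have "primitive g 1 = 0"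
      using u by (simp add: primitive_0)
    then show "\<eta> \<in> {\<eta>. \<eta> \<bullet> const_l2 1 = 0}"
      using g by (simp add: inner1)
  next
    fix \<eta> assume "\<eta> \<in> {\<eta>. \<eta> \<bullet> const_l2 1 = 0}"
    then have \<eta>: "\<eta> \<bullet> const_l2 1 = 0" by simp
    obtain g where g: "square_integrable g" "\<eta> = abs_l2 g"
      by (rule l2_cases)
    have G: "continuous_on {0..1} (primitive g)"
      using g by (simp add: continuous_on_primitive square_integrable_imp_integrable)
    have hwd: "has_weak_derivative (abs_l2 (primitive g)) \<eta>"
      using g by (simp add: has_weak_derivative_primitive)
    moreover have "represents (primitive g) (abs_l2 (primitive g))"
      using square_integrable_continuous[OF G] by (simp add: represents_abs_l2)
    ultimately have "abs_l2 (primitive g) \<in> W12_0"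
      using G \<eta> g inner1[of g] unfolding W12_0_def W12_def by (auto simp: primitive_0)
    then show "\<eta> \<in> weak_deriv ` W12_0"
      using weak_deriv_eq[OF hwd] by blast
  qed
qed

theorem proposition1:
  shows "subspace A2 \<and> subspace (weak_deriv ` W12_0) \<and>
    (\<forall>g\<in>A2. \<forall>\<eta>\<in>weak_deriv ` W12_0. orthogonal g \<eta>) \<and>
    (\<forall>f::l2. \<exists>!(g, \<eta>). g \<in> A2 \<and> \<eta> \<in> weak_deriv ` W12_0 \<and> f = g + \<eta>)"
proof (intro conjI ballI allI)
  let ?e = "const_l2 1"
  have A2: "A2 = range (\<lambda>c. c *\<^sub>R ?e)"
    unfolding A2_eq by (rule image_cong[OF refl const_l2_eq_scaleR])
  show "subspace A2"
    unfolding A2 span_singleton[symmetric] by (rule subspace_span)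
  show "subspace (weak_deriv ` W12_0)"
    unfolding weak_deriv_W12_0_eq by (auto simp: subspace_def inner_simps)
  show "orthogonal g \<eta>" if "g \<in> A2" "\<eta> \<in> weak_deriv ` W12_0" for g \<eta>
    using that unfolding A2 weak_deriv_W12_0_eq by (auto simp: orthogonal_def inner_commute)
  fix f :: l2
  show "\<exists>!(g, \<eta>). g \<in> A2 \<and> \<eta> \<in> weak_deriv ` W12_0 \<and> f = g + \<eta>"
  \<comment> \<open>The first component is the orthogonal projection of \<open>f\<close> onto the
    line spanned by the unit vector \<open>?e\<close>.\<close>
  proof (rule ex1I[of _ "((f \<bullet> ?e) *\<^sub>R ?e, f - (f \<bullet> ?e) *\<^sub>R ?e)"])
    show "case ((f \<bullet> ?e) *\<^sub>R ?e, f - (f \<bullet> ?e) *\<^sub>R ?e) of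
        (g, \<eta>) \<Rightarrow> g \<in> A2 \<and> \<eta> \<in> weak_deriv ` W12_0 \<and> f = g + \<eta>"
      unfolding A2 weak_deriv_W12_0_eq by (auto simp: inner_simps inner_const_l2_one)
    fix p assume "case p of (g, \<eta>) \<Rightarrow> g \<in> A2 \<and> \<eta> \<in> weak_deriv ` W12_0 \<and> f = g + \<eta>"
    then obtain c \<eta> where p: "p = (c *\<^sub>R ?e, \<eta>)" "\<eta> \<bullet> ?e = 0" "f = c *\<^sub>R ?e + \<eta>"
      unfolding A2 weak_deriv_W12_0_eq by auto
    \<comment> \<open>Pairing any decomposition with \<open>?e\<close> removes \<open>\<eta>\<close>
      and recovers the coefficient, whence uniqueness.\<close>
    then have "f \<bullet> ?e = c"
      by (simp add: inner_simps inner_const_l2_one)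
    with p show "p = ((f \<bullet> ?e) *\<^sub>R ?e, f - (f \<bullet> ?e) *\<^sub>R ?e)" by simp
  qed
qed

end
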